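(* An atomless order continuous Banach lattice $E$ cannot admit a residually quasi-monotone finite dimensional decomposition.
   Context: A vector lattice $E$ is atomless if it has no atom, where an element $e>0$ is an atom if whenever $0\le f_1\le e$, $0\le f_2\le e$ and $f_1\perp f_2$, then $f_1=0$ or $f_2=0$. A Banach lattice is order continuous if its norm is order continuous. A sequence $(E_n)_{n=1}^\infty$ of finite dimensional subspaces of a Banach space $E$ is a finite dimensional decomposition (FDD) of $E$ if for every $e\in E$ there is a unique sequence $(u_n)_{n=1}^\infty$ with $u_n\in E_n$ and $e=\sum_{n=1}^\infty u_n$ (norm convergence). The corresponding basis projections are $P_n\bigl(\sum_{k=1}^\infty u_k\bigr)=\sum_{k=1}^n u_k$, and the residual projections are $Q_n=\mathrm{Id}-P_n$, where $\mathrm{Id}$ is the identity operator on $E$. A linear operator $T:E\to F$ between ordered vector spaces is quasi-monotone with a constant $M>0$ if for all $x,y\in E^+$ the inequality $x\le y$ implies $Tx\le M\,Ty$. An FDD $(E_n)$ of a Banach lattice $E$ is residually quasi-monotone if there is a constant $M>0$ such that all the residual projections $Q_n$, $n\in\mathbb N$, are quasi-monotone with constant $M$. *)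

theory Defs
  imports "HOL-Analysis.Analysis" "HOL-Library.Lattice_Algebras"
begin

section \<open>Banach lattices\<close>

text \<open>In \<^class>\<open>lattice_ab_group_add_abs\<close> the modulus is \<open>\<bar>x\<bar> = sup x (- x)\<close>.\<close>

class banach_lattice = banach + ordered_real_vector + lattice_ab_group_add_abs +
  assumes norm_mono_abs: "\<bar>x\<bar> \<le> \<bar>y\<bar> \<Longrightarrow> norm x \<le> norm y"

instance real :: banach_lattice
  by standard simp

definition disjoint_elements :: "'a::banach_lattice \<Rightarrow> 'a \<Rightarrow> bool" where
  "disjoint_elements x y \<longleftrightarrow> inf \<bar>x\<bar> \<bar>y\<bar> = 0"

definition atom :: "'a::banach_lattice \<Rightarrow> bool" where
  "atom e \<longleftrightarrow> 0 < e \<and>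
     (\<forall>f1 f2. 0 \<le> f1 \<longrightarrow> f1 \<le> e \<longrightarrow> 0 \<le> f2 \<longrightarrow> f2 \<le> e \<longrightarrow>
        disjoint_elements f1 f2 \<longrightarrow> f1 = 0 \<or> f2 = 0)"

definition atomless :: "'a::banach_lattice itself \<Rightarrow> bool" where
  "atomless _ \<longleftrightarrow> \<not> (\<exists>e::'a. atom e)"

definition downward_directed :: "'a::order set \<Rightarrow> bool" where
  "downward_directed D \<longleftrightarrow> D \<noteq> {} \<and> (\<forall>x\<in>D. \<forall>y\<in>D. \<exists>z\<in>D. z \<le> x \<and> z \<le> y)"

definition is_infimum :: "'a::order \<Rightarrow> 'a set \<Rightarrow> bool" where
  "is_infimum m D \<longleftrightarrow> (\<forall>x\<in>D. m \<le> x) \<and> (\<forall>l. (\<forall>x\<in>D. l \<le> x) \<longrightarrow> l \<le> m)"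

text \<open>
  The norm is order continuous if \<open>norm (x \<alpha>) \<rightarrow> 0\<close> for every net \<open>x\<close> decreasing to \<open>0\<close>.
  To avoid quantifying over index types, a decreasing net is given as a downward directed
  set \<open>D\<close> indexed by its own elements, later indices being the smaller elements; the last
  line is convergence of the norm along this net. Lemma \<open>order_continuous_norm_net\<close>
  recovers the property for nets over arbitrary index types.
\<close>

definition order_continuous_norm :: "'a::banach_lattice itself \<Rightarrow> bool" where
  "order_continuous_norm _ \<longleftrightarrow>
     (\<forall>D::'a set. downward_directed D \<longrightarrow> is_infimum 0 D \<longrightarrow>
        (\<forall>\<epsilon>>0. \<exists>d\<in>D. \<forall>x\<in>D. x \<le> d \<longrightarrow> norm x < \<epsilon>))"

lemma order_continuous_norm_net:
  fixes x :: "'i \<Rightarrow> 'a::banach_lattice" and le :: "'i \<Rightarrow> 'i \<Rightarrow> bool"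
  assumes "order_continuous_norm TYPE('a)"
    and "I \<noteq> {}"
    and directed: "\<And>i j. i \<in> I \<Longrightarrow> j \<in> I \<Longrightarrow> \<exists>k\<in>I. le i k \<and> le j k"
    and decreasing: "\<And>i j. i \<in> I \<Longrightarrow> j \<in> I \<Longrightarrow> le i j \<Longrightarrow> x j \<le> x i"
    and "is_infimum 0 (x ` I)"
    and "\<epsilon> > 0"
  shows "\<exists>i\<in>I. \<forall>j\<in>I. le i j \<longrightarrow> norm (x j) < \<epsilon>"
proof -
  have "downward_directed (x ` I)"
    unfolding downward_directed_def
  proof (intro conjI ballI)
    show "x ` I \<noteq> {}" using \<open>I \<noteq> {}\<close> by simp
    fix a b assume "a \<in> x ` I" "b \<in> x ` I"
    then obtain i j where "i \<in> I" "j \<in> I" "a = x i" "b = x j" by blast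
    with directed[of i j] decreasing show "\<exists>z\<in>x ` I. z \<le> a \<and> z \<le> b" by blast
  qed
  then obtain i where "i \<in> I" "\<forall>y\<in>x ` I. y \<le> x i \<longrightarrow> norm y < \<epsilon>"
    using assms(1,5,6) unfolding order_continuous_norm_def by blast
  then show ?thesis
    using decreasing by blast
qed

section \<open>Finite dimensional decompositions\<close>

text \<open>
  Sequences are indexed from \<open>0\<close>, so \<open>basis_projection E n\<close> is the sum of the first
  \<open>n + 1\<close> components; \<open>n\<close> ranging over \<^typ>\<open>nat\<close> gives exactly the projections
  \<open>P\<^sub>1, P\<^sub>2, \<dots>\<close> of the usual indexing from \<open>1\<close>.
\<close>

definition fdd :: "(nat \<Rightarrow> 'a::banach set) \<Rightarrow> bool" where
  "fdd E \<longleftrightarrow>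
     (\<forall>n. subspace (E n) \<and> (\<exists>B. finite B \<and> E n = span B)) \<and>
     (\<forall>e. \<exists>!u. (\<forall>n. u n \<in> E n) \<and> u sums e)"

definition fdd_component :: "(nat \<Rightarrow> 'a::banach set) \<Rightarrow> 'a \<Rightarrow> nat \<Rightarrow> 'a" where
  "fdd_component E e = (THE u. (\<forall>n. u n \<in> E n) \<and> u sums e)"

definition basis_projection :: "(nat \<Rightarrow> 'a::banach set) \<Rightarrow> nat \<Rightarrow> 'a \<Rightarrow> 'a" where
  "basis_projection E n e = (\<Sum>k\<le>n. fdd_component E e k)"

definition residual_projection :: "(nat \<Rightarrow> 'a::banach set) \<Rightarrow> nat \<Rightarrow> 'a \<Rightarrow> 'a" where
  "residual_projection E n e = e - basis_projection E n e"

lemma fdd_component_eqI: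
  assumes "fdd E" "\<And>n. u n \<in> E n" "u sums e"
  shows "fdd_component E e = u"
  using assms unfolding fdd_def fdd_component_def
  by (intro the1_equality) auto

lemma fdd_component:
  assumes "fdd E"
  shows "fdd_component E e n \<in> E n" and "fdd_component E e sums e"
proof -
  obtain u where u: "\<And>n. u n \<in> E n" "u sums e"
    using assms unfolding fdd_def by blast
  have "fdd_component E e = u"
    using fdd_component_eqI[OF assms u] .
  with u show "fdd_component E e n \<in> E n" "fdd_component E e sums e" by simp_all
qed

lemma linear_residual_projection:
  assumes "fdd E"
  shows "linear (residual_projection E n)"
proof -
  have sub: "subspace (E k)" for k
    using assms unfolding fdd_def by blast
  have add: "fdd_component E (x + y) = (\<lambda>k. fdd_component E x k + fdd_component E y k)" for x y
    by (intro fdd_component_eqI assms sums_add fdd_component subspace_add[OF sub])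
  have scale: "fdd_component E (c *\<^sub>R x) = (\<lambda>k. c *\<^sub>R fdd_component E x k)" for c x
    by (intro fdd_component_eqI assms sums_scaleR_right fdd_component subspace_scale[OF sub])
  show ?thesis
    by (rule linearI)
      (simp_all add: residual_projection_def basis_projection_def add scale sum.distrib
        scaleR_sum_right scaleR_diff_right)
qed

section \<open>Quasi-monotone operators\<close>

text \<open>
  Used for linear \<open>T\<close> and \<open>M > 0\<close>; residual projections are linear by
  \<open>linear_residual_projection\<close>.
\<close>

definition quasi_monotone ::
    "real \<Rightarrow> ('a::ordered_real_vector \<Rightarrow> 'b::ordered_real_vector) \<Rightarrow> bool" where
  "quasi_monotone M T \<longleftrightarrow> (\<forall>x y. 0 \<le> x \<longrightarrow> 0 \<le> y \<longrightarrow> x \<le> y \<longrightarrow> T x \<le> M *\<^sub>R T y)"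

definition residually_quasi_monotone :: "(nat \<Rightarrow> 'a::banach_lattice set) \<Rightarrow> bool" where
  "residually_quasi_monotone E \<longleftrightarrow>
     (\<exists>M>0. \<forall>n. quasi_monotone M (residual_projection E n))"

end

theory Submission
  imports Defs
begin

text \<open>
  Comparing \<open>0\<close> with \<open>x \<ge> 0\<close> in the definition of quasi-monotonicity shows that every residual
  projection \<open>Q\<close> is a positive operator, while \<open>P = Id - Q\<close> has finite rank. The theorem rests on
  the inequality \<open>norm e \<le> norm (Q e)\<close> for all such \<open>Q\<close> and all \<open>e \<ge> 0\<close>
  (\<open>positive_finite_rank_perturbation\<close>): since the residuals \<open>Q\<^sub>n e\<close> tend to \<open>0\<close>, it forces
  \<open>e = 0\<close>.

  Here \<open>Q\<close>, being positive, is bounded (\<open>positive_operator_bounded\<close>), and hence so is \<open>P\<close>. The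
  inequality holds because a bounded finite-rank operator on an atomless order continuous Banach lattice
  nearly annihilates some \<open>r\<close> whose modulus is nearly \<open>e\<close> (\<open>finite_rank_balanced\<close>). For such an
  \<open>r\<close> one has \<open>r \<approx> Q r\<close>, and positivity gives \<open>\<bar>Q r\<bar> \<le> Q \<bar>r\<bar> \<le> Q e\<close>.

  To obtain \<open>r\<close>, almost exhaust \<open>e\<close> by finitely many disjoint pieces \<open>p\<^sub>i\<close> of small norm
  (\<open>small_disjoint_pieces\<close>) and put \<open>r = (\<Sum>i. \<plusminus> p\<^sub>i)\<close>; disjointness gives \<open>\<bar>r\<bar> = (\<Sum>i. p\<^sub>i)\<close> for
  every choice of signs. A greedy choice of signs, as for orthogonal vectors in a Euclidean space,
  makes the sum of the squares of the coordinates of \<open>P r\<close> at most the sum of the squares of all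
  coordinates of all \<open>P p\<^sub>i\<close>. This is small: each coordinate \<open>\<phi>\<close> of \<open>P\<close> is a bounded functional, so
  \<open>\<bar>\<phi> p\<^sub>i\<bar>\<close> is uniformly small, whereas \<open>(\<Sum>i. \<bar>\<phi> p\<^sub>i\<bar>)\<close> stays bounded, being the value of \<open>\<phi>\<close> at
  another signed sum of the pieces.
\<close>

section \<open>Order and norm in a Banach lattice\<close>

lemma norm_abs_eq: "norm \<bar>x\<bar> = norm (x::'a::banach_lattice)"
  by (rule antisym) (rule norm_mono_abs, simp)+

lemma norm_mono_pos: "0 \<le> x \<Longrightarrow> x \<le> y \<Longrightarrow> norm x \<le> norm (y::'a::banach_lattice)"
  by (rule norm_mono_abs) simp

lemma archimedean_eq_0:
  fixes z :: "'a::banach_lattice"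
  assumes "0 \<le> z" and "\<And>k::nat. real k *\<^sub>R z \<le> y"
  shows "z = 0"
proof (rule ccontr)
  assume "z \<noteq> 0"
  then have pos: "norm z > 0" by simp
  obtain k :: nat where k: "norm y < real k * norm z"
    using reals_Archimedean3[OF pos] by blast
  have "norm (real k *\<^sub>R z) \<le> norm y"
    by (rule norm_mono_pos) (use assms in \<open>auto intro: scaleR_nonneg_nonneg\<close>)
  with k show False by simp
qed

text \<open>
  The negative part of \<open>l\<close> is dominated by \<open>\<bar>u m - l\<bar>\<close>, hence has norm \<open>0\<close>.
\<close>

lemma nonneg_limit:
  fixes u :: "nat \<Rightarrow> 'a::banach_lattice"
  assumes lim: "u \<longlonglongrightarrow> l" and nn: "\<And>m. m \<ge> n \<Longrightarrow> 0 \<le> u m"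
  shows "0 \<le> l"
proof -
  have le: "norm (sup (- l) 0) \<le> norm (u m - l)" if "m \<ge> n" for m
  proof (rule norm_mono_abs)
    have "- l \<le> u m - l" using nn[OF that] by simp
    also have "\<dots> \<le> \<bar>u m - l\<bar>" by (rule abs_ge_self)
    finally show "\<bar>sup (- l) 0\<bar> \<le> \<bar>u m - l\<bar>" by simp
  qed
  have "(\<lambda>m. norm (u m - l)) \<longlonglongrightarrow> 0"
    using lim by (simp add: LIM_zero tendsto_norm_zero)
  then have "norm (sup (- l) 0) \<le> 0"
    by (rule LIMSEQ_le_const) (use le in blast)
  then have "sup (- l) 0 = 0" by simp
  then show ?thesis by (metis neg_le_0_iff_le sup.cobounded1)
qed

text \<open>
  A gliding hump: if \<open>Q\<close> were unbounded, there would be a convergent series of positive terms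
  \<open>y n\<close> with \<open>norm (Q (y n)) > 2 ^ n\<close>. Each term lies below the sum of the series, so by
  positivity \<open>Q\<close> of the sum would have norm above every \<open>2 ^ n\<close>.
\<close>

lemma positive_operator_bounded:
  fixes Q :: "'a::banach_lattice \<Rightarrow> 'a"
  assumes lin: "linear Q" and pos: "\<And>x. 0 \<le> x \<Longrightarrow> 0 \<le> Q x"
  obtains K where "\<And>x. norm (Q x) \<le> K * norm x"
proof -
  have "\<exists>K. \<forall>x\<ge>0. norm (Q x) \<le> K * norm x"
  proof (rule ccontr)
    assume "\<not> ?thesis"
    then have "\<forall>n::nat. \<exists>x\<ge>0. norm (Q x) > 4 ^ n * norm x"
      by (metis not_le)
    then obtain x where x0: "\<And>n. 0 \<le> x n" and xQ: "\<And>n::nat. norm (Q (x n)) > 4 ^ n * norm (x n)"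
      by metis
    have xn: "norm (x n) > 0" for n
      using xQ[of n] linear_0[OF lin] by (cases "x n = 0") auto
    define y where "y n = (inverse (2 ^ n) / norm (x n)) *\<^sub>R x n" for n
    have y0: "0 \<le> y n" for n
      unfolding y_def using x0 by (intro scaleR_nonneg_nonneg) auto
    have ny: "norm (y n) = (1/2) ^ n" for n
      using xn[of n] by (simp add: y_def power_one_over field_simps)
    have nQ: "norm (Q (y n)) > 2 ^ n" for n
    proof -
      have "norm (Q (y n)) = inverse (2 ^ n) / norm (x n) * norm (Q (x n))"
        by (simp add: y_def linear_scale[OF lin])
      also have "\<dots> > inverse (2 ^ n) / norm (x n) * (4 ^ n * norm (x n))"
        using xQ[of n] xn[of n] by (intro mult_strict_left_mono) auto
      also have "inverse (2 ^ n) / norm (x n) * (4 ^ n * norm (x n)) = (2::real) ^ n"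
        using xn[of n] by (simp add: field_simps power_mult_distrib[symmetric])
      finally show ?thesis .
    qed
    have "summable y"
      by (rule summable_norm_cancel) (simp add: ny summable_geometric)
    then have lim: "(\<lambda>m. sum y {..<m}) \<longlonglongrightarrow> suminf y"
      by (rule summable_LIMSEQ)
    have le: "y n \<le> suminf y" for n
    proof -
      have "(\<lambda>m. sum y {..<m} - y n) \<longlonglongrightarrow> suminf y - y n"
        using lim by (intro tendsto_intros)
      moreover have "0 \<le> sum y {..<m} - y n" if "m \<ge> Suc n" for m
        using that y0 sum_mono2[of "{..<m}" "{n}" y] by auto
      ultimately have "0 \<le> suminf y - y n"
        by (rule nonneg_limit)
      then show ?thesis by simp
    qed
    have "Q (y n) \<le> Q (suminf y)" for n
      using pos[of "suminf y - y n"] le[of n] by (simp add: linear_diff[OF lin])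
    then have "norm (Q (y n)) \<le> norm (Q (suminf y))" for n
      using pos[OF y0] by (intro norm_mono_pos) auto
    then have "2 ^ n < norm (Q (suminf y))" for n :: nat
      using nQ[of n] by (meson less_le_trans)
    moreover obtain n :: nat where "norm (Q (suminf y)) < 2 ^ n"
      using real_arch_pow[of 2] by auto
    ultimately show False by (meson less_asym)
  qed
  then obtain K where K: "\<And>x. 0 \<le> x \<Longrightarrow> norm (Q x) \<le> K * norm x" by blast
  have "norm (Q x) \<le> K * norm x" for x
  proof -
    have "0 \<le> Q (\<bar>x\<bar> - x)" "0 \<le> Q (\<bar>x\<bar> - - x)"
      using abs_ge_self[of x] abs_ge_minus_self[of x] by (intro pos; simp only: diff_ge_0_iff_ge)+
    then have "Q x \<le> Q \<bar>x\<bar>" "- Q x \<le> Q \<bar>x\<bar>"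
      unfolding linear_diff[OF lin] linear_neg[OF lin] diff_ge_0_iff_ge .
    then have "\<bar>Q x\<bar> \<le> \<bar>Q \<bar>x\<bar>\<bar>"
      using pos[of "\<bar>x\<bar>"] by (simp add: abs_le_iff)
    then have "norm (Q x) \<le> norm (Q \<bar>x\<bar>)" by (rule norm_mono_abs)
    also have "\<dots> \<le> K * norm x" using K[of "\<bar>x\<bar>"] by (simp add: norm_abs_eq)
    finally show ?thesis .
  qed
  then show thesis using that by blast
qed

section \<open>Coordinates in a finite-dimensional subspace\<close>

text \<open>
  Induction on the basis. The bound for the vectors treated so far makes their span closed, because
  coefficients of a Cauchy sequence are Cauchy; so a new basis vector \<open>a\<close> has positive distance
  \<open>d\<close> from this span, which bounds the coefficient of \<open>a\<close> by \<open>1 / d\<close> times the norm.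
\<close>

lemma coordinates_bounded:
  fixes B :: "'a::real_normed_vector set"
  assumes "finite B" and "independent B"
  shows "\<exists>C. \<forall>c. \<forall>b\<in>B. \<bar>c b\<bar> \<le> C * norm (\<Sum>b\<in>B. c b *\<^sub>R b)"
  using assms
proof (induction B rule: finite_induct)
  case empty
  then show ?case by simp
next
  case (insert a B)
  have ind: "independent B" and aB: "a \<notin> span B"
    using insert.prems insert.hyps by (simp_all add: independent_insert)
  obtain C0 where C0: "\<And>c b. b \<in> B \<Longrightarrow> \<bar>c b\<bar> \<le> C0 * norm (\<Sum>b\<in>B. c b *\<^sub>R b)"
    using insert.IH[OF ind] by blast
  define C where "C = \<bar>C0\<bar> + 1"
  have C: "\<bar>c b\<bar> \<le> C * norm (\<Sum>b\<in>B. c b *\<^sub>R b)" if "b \<in> B" for c b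
    by (rule order_trans[OF C0[OF that]], rule mult_right_mono) (auto simp: C_def)
  have Cpos: "C > 0" by (simp add: C_def)
  have "\<exists>d>0. \<forall>c. d \<le> norm (a - (\<Sum>b\<in>B. c b *\<^sub>R b))"
  proof (rule ccontr)
    assume "\<not> ?thesis"
    then have "\<forall>n::nat. \<exists>c. norm (a - (\<Sum>b\<in>B. c b *\<^sub>R b)) < inverse (real (Suc n))"
      by (metis inverse_positive_iff_positive not_le of_nat_0_less_iff zero_less_Suc)
    then obtain c where c: "\<And>n. norm (a - (\<Sum>b\<in>B. c n b *\<^sub>R b)) < inverse (real (Suc n))"
      by metis
    define s where "s n = (\<Sum>b\<in>B. c n b *\<^sub>R b)" for n
    have slim: "s \<longlonglongrightarrow> a"
    proof (rule LIM_zero_cancel, rule Lim_null_comparison)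
      show "\<forall>\<^sub>F n in sequentially. norm (s n - a) \<le> inverse (real (Suc n))"
        using c by (intro always_eventually allI) (simp add: s_def norm_minus_commute less_imp_le)
      show "(\<lambda>n. inverse (real (Suc n))) \<longlonglongrightarrow> 0" by (rule LIMSEQ_inverse_real_of_nat)
    qed
    then have scau: "Cauchy s" by (rule LIMSEQ_imp_Cauchy)
    have "convergent (\<lambda>n. c n b)" if "b \<in> B" for b
    proof (rule Cauchy_convergent, rule metric_CauchyI)
      fix \<epsilon> :: real assume "\<epsilon> > 0"
      then obtain N where N: "\<And>m n. m \<ge> N \<Longrightarrow> n \<ge> N \<Longrightarrow> dist (s m) (s n) < \<epsilon> / C"
        using metric_CauchyD[OF scau, of "\<epsilon> / C"] Cpos by auto
      have "dist (c m b) (c n b) < \<epsilon>" if "m \<ge> N" "n \<ge> N" for m n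
      proof -
        have "\<bar>c m b - c n b\<bar> \<le> C * norm (s m - s n)"
          using C[OF \<open>b \<in> B\<close>, of "\<lambda>b. c m b - c n b"]
          by (simp add: s_def scaleR_diff_left sum_subtractf)
        also have "\<dots> < \<epsilon>"
          using N[OF that] Cpos by (simp add: dist_norm field_simps)
        finally show ?thesis by (simp add: dist_norm)
      qed
      then show "\<exists>M. \<forall>m\<ge>M. \<forall>n\<ge>M. dist (c m b) (c n b) < \<epsilon>" by blast
    qed
    then have "s \<longlonglongrightarrow> (\<Sum>b\<in>B. lim (\<lambda>n. c n b) *\<^sub>R b)"
      unfolding s_def by (intro tendsto_sum tendsto_scaleR tendsto_const)
        (simp add: convergent_LIMSEQ_iff)
    then have "a = (\<Sum>b\<in>B. lim (\<lambda>n. c n b) *\<^sub>R b)"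
      using slim LIMSEQ_unique by blast
    moreover have "(\<Sum>b\<in>B. lim (\<lambda>n. c n b) *\<^sub>R b) \<in> span B"
      by (intro span_sum span_scale span_base)
    ultimately show False using aB by simp
  qed
  then obtain d where d: "d > 0" "\<And>c. d \<le> norm (a - (\<Sum>b\<in>B. c b *\<^sub>R b))" by blast
  define D where "D = 1 / d + C * (1 + norm a / d)"
  have "\<bar>c b\<bar> \<le> D * norm (\<Sum>b\<in>insert a B. c b *\<^sub>R b)" if "b \<in> insert a B" for c b
  proof -
    define w where "w = (\<Sum>b\<in>B. c b *\<^sub>R b)"
    define v where "v = (\<Sum>b\<in>insert a B. c b *\<^sub>R b)"
    have v: "v = c a *\<^sub>R a + w" using insert.hyps by (simp add: v_def w_def)
    have ca: "\<bar>c a\<bar> * d \<le> norm v"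
    proof (cases "c a = 0")
      case False
      have "v = c a *\<^sub>R (a - (\<Sum>b\<in>B. (- c b / c a) *\<^sub>R b))"
        using False by (simp add: v w_def scaleR_sum_right algebra_simps sum_negf)
      then have "norm v = \<bar>c a\<bar> * norm (a - (\<Sum>b\<in>B. (- c b / c a) *\<^sub>R b))" by simp
      then show ?thesis using d(2)[of "\<lambda>b. - c b / c a"] by (simp add: mult_left_mono)
    qed simp
    then have ca': "\<bar>c a\<bar> \<le> (1 / d) * norm v" using d(1) by (simp add: field_simps)
    have "norm w \<le> norm v + \<bar>c a\<bar> * norm a"
      using norm_triangle_ineq4[of v "c a *\<^sub>R a"] by (simp add: v)
    also have "\<dots> \<le> norm v + (1 / d * norm v) * norm a"
      using ca' by (intro add_left_mono mult_right_mono) auto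
    also have "\<dots> = (1 + norm a / d) * norm v" by (simp add: algebra_simps)
    finally have w: "C * norm w \<le> C * (1 + norm a / d) * norm v"
      unfolding mult.assoc using Cpos by (intro mult_left_mono) auto
    show ?thesis
    proof (cases "b = a")
      case True
      have "1 / d * norm v \<le> D * norm v"
        using Cpos d(1) by (intro mult_right_mono) (auto simp: D_def)
      with True ca' show ?thesis by (simp add: v_def)
    next
      case False
      have "\<bar>c b\<bar> \<le> C * norm w" using C[of b c] False that by (simp add: w_def)
      also note w
      also have "C * (1 + norm a / d) * norm v \<le> D * norm v"
        using d(1) by (intro mult_right_mono) (auto simp: D_def)
      finally show ?thesis by (simp add: v_def)
    qed
  qed
  then show ?case by blast
qed

section \<open>Disjoint positive elements\<close>

lemma inf_add_eq_0:
  fixes a b c :: "'a::lattice_ab_group_add"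
  assumes "0 \<le> a" "0 \<le> b" "0 \<le> c" "inf a b = 0" "inf a c = 0"
  shows "inf a (b + c) = 0"
proof (rule antisym)
  let ?w = "inf a (b + c)"
  have "?w - b \<le> a" using assms(2) by (simp add: diff_le_eq add_increasing2 le_infI1)
  moreover have "?w - b \<le> c" by (simp add: diff_le_eq add.commute le_infI2)
  ultimately have "?w - b \<le> inf a c" by simp
  then have "?w \<le> b" by (simp add: assms)
  then have "?w \<le> inf a b" by simp
  then show "?w \<le> 0" by (simp add: assms)
qed (use assms in simp)

lemma inf_sum_eq_0:
  fixes p :: "'i \<Rightarrow> 'a::lattice_ab_group_add"
  assumes "finite F" "0 \<le> a" "\<And>i. i \<in> F \<Longrightarrow> 0 \<le> p i" "\<And>i. i \<in> F \<Longrightarrow> inf a (p i) = 0"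
  shows "inf a (sum p F) = 0"
  using assms by (induction F rule: finite_induct)
    (auto intro!: inf_add_eq_0 sum_nonneg simp: inf_absorb2)

lemma disjoint_sum_le:
  fixes p :: "'i \<Rightarrow> 'a::lattice_ab_group_add"
  assumes "finite F" "0 \<le> e" "\<And>i. i \<in> F \<Longrightarrow> 0 \<le> p i" "\<And>i. i \<in> F \<Longrightarrow> p i \<le> e"
    and "pairwise (\<lambda>i j. inf (p i) (p j) = 0) F"
  shows "sum p F \<le> e"
  using assms
proof (induction F rule: finite_induct)
  case (insert a F)
  have "inf (p a) (sum p F) = 0"
    using insert.prems insert.hyps by (intro inf_sum_eq_0) (auto simp: pairwise_insert)
  then have "p a + sum p F = sup (p a) (sum p F)"
    using add_eq_inf_sup[of "p a" "sum p F"] by simp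
  moreover have "sum p F \<le> e"
    using insert by (auto simp: pairwise_insert)
  ultimately show ?case using insert by simp
qed simp

lemma disjoint_scaled_inf:
  fixes a b e :: "'a::banach_lattice"
  assumes "0 \<le> a" "0 \<le> b" "0 \<le> e" "inf a b = 0"
  shows "inf (inf (real k *\<^sub>R a) e) (inf (real m *\<^sub>R b) e) = 0"
proof (rule antisym)
  let ?c = "inf (inf (real k *\<^sub>R a) e) (inf (real m *\<^sub>R b) e)"
  define n where "n = real k + real m + 1"
  have n: "n > 0" by (simp add: n_def)
  have "?c \<le> real k *\<^sub>R a" by (simp add: le_infI1)
  also have "\<dots> \<le> n *\<^sub>R a" using assms by (intro scaleR_right_mono) (auto simp: n_def)
  finally have 1: "(1/n) *\<^sub>R ?c \<le> a"
    using n scaleR_left_mono[of ?c "n *\<^sub>R a" "1/n"] by simp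
  have "?c \<le> real m *\<^sub>R b" by (simp add: le_infI2 le_infI1)
  also have "\<dots> \<le> n *\<^sub>R b" using assms by (intro scaleR_right_mono) (auto simp: n_def)
  finally have 2: "(1/n) *\<^sub>R ?c \<le> b"
    using n scaleR_left_mono[of ?c "n *\<^sub>R b" "1/n"] by simp
  have "(1/n) *\<^sub>R ?c \<le> inf a b" using 1 2 by simp
  then have "n *\<^sub>R ((1/n) *\<^sub>R ?c) \<le> n *\<^sub>R 0"
    using n assms(4) by (intro scaleR_left_mono) auto
  then show "?c \<le> 0" using n by simp
qed (use assms in \<open>simp add: scaleR_nonneg_nonneg\<close>)

lemma abs_diff_disjoint:
  fixes a b :: "'a::banach_lattice"
  assumes "0 \<le> a" "0 \<le> b" "inf a b = 0"
  shows "\<bar>a - b\<bar> = a + b"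
proof (rule antisym)
  show "\<bar>a - b\<bar> \<le> a + b" using abs_triangle_ineq4[of a b] assms by simp
  let ?w = "a + b - \<bar>a - b\<bar>"
  have "?w \<le> 2 *\<^sub>R b" using abs_ge_self[of "a - b"] by (simp add: scaleR_2 algebra_simps)
  moreover have "?w \<le> 2 *\<^sub>R a" using abs_ge_minus_self[of "a - b"] by (simp add: scaleR_2 algebra_simps)
  ultimately have "(1/2) *\<^sub>R ?w \<le> inf a b"
    using scaleR_left_mono[of ?w "2 *\<^sub>R b" "1/2"] scaleR_left_mono[of ?w "2 *\<^sub>R a" "1/2"] by simp
  then have "2 *\<^sub>R ((1/2) *\<^sub>R ?w) \<le> 2 *\<^sub>R 0"
    using assms(3) by (intro scaleR_left_mono) auto
  then show "a + b \<le> \<bar>a - b\<bar>" by simp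
qed

text \<open>
  The terms with sign \<open>1\<close> and those with sign \<open>- 1\<close> have disjoint sums \<open>a\<close> and \<open>b\<close>, and
  \<open>\<bar>a - b\<bar> = a + b\<close> for such elements.
\<close>

lemma abs_signed_disjoint_sum:
  fixes p :: "'i \<Rightarrow> 'a::banach_lattice"
  assumes fin: "finite F" and nn: "\<And>i. i \<in> F \<Longrightarrow> 0 \<le> p i"
    and dis: "pairwise (\<lambda>i j. inf (p i) (p j) = 0) F"
    and sg: "\<And>i. s i = 1 \<or> s i = - 1"
  shows "\<bar>\<Sum>i\<in>F. s i *\<^sub>R p i\<bar> = sum p F"
proof -
  let ?A = "{i\<in>F. s i = 1}" and ?B = "{i\<in>F. s i \<noteq> 1}"
  have F: "F = ?A \<union> ?B" "?A \<inter> ?B = {}" by auto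
  have split: "sum f F = sum f ?A + sum f ?B" for f :: "'i \<Rightarrow> 'a"
    by (subst F(1), rule sum.union_disjoint) (use fin in auto)
  have B: "(\<Sum>i\<in>?B. s i *\<^sub>R p i) = - sum p ?B"
    unfolding sum_negf[symmetric] using sg by (intro sum.cong) (auto, metis scaleR_minus1_left)
  have "(\<Sum>i\<in>F. s i *\<^sub>R p i) = sum p ?A - sum p ?B"
    unfolding split[of "\<lambda>i. s i *\<^sub>R p i"] B by simp
  moreover have "inf (sum p ?A) (sum p ?B) = 0"
  proof (rule inf_sum_eq_0)
    fix i assume i: "i \<in> ?B"
    have "inf (p i) (sum p ?A) = 0"
      using i fin nn dis by (intro inf_sum_eq_0) (auto simp: pairwise_def)
    then show "inf (sum p ?A) (p i) = 0" by (simp add: inf.commute)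
  qed (use fin nn in \<open>auto intro: sum_nonneg\<close>)
  moreover have "0 \<le> sum p ?A" "0 \<le> sum p ?B"
    using nn by (auto intro: sum_nonneg)
  ultimately show ?thesis
    using abs_diff_disjoint[of "sum p ?A" "sum p ?B"] split[of p] by simp
qed

section \<open>Cutting an element into small disjoint pieces\<close>

text \<open>
  By disjointness the partial sums \<open>s n\<close> are bounded by \<open>e\<close>. To apply order continuity without
  first constructing their supremum, consider the differences \<open>y - s n\<close>, where \<open>y\<close> runs through
  all upper bounds of the partial sums. They have infimum \<open>0\<close>: if \<open>m \<ge> 0\<close> lies
  below all of them, then \<open>y - m\<close> is again an upper bound, and so is \<open>y - k m\<close> for every \<open>k\<close>. Some
  \<open>y - s n\<close> therefore has small norm, and it dominates \<open>z n\<close>.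
\<close>

lemma disjoint_sequence_norm_small:
  fixes z :: "nat \<Rightarrow> 'a::banach_lattice"
  assumes oc: "order_continuous_norm TYPE('a)"
    and nn: "\<And>n. 0 \<le> z n" and le: "\<And>n. z n \<le> e"
    and dis: "pairwise (\<lambda>i j. inf (z i) (z j) = 0) UNIV"
    and "\<epsilon> > 0"
  shows "\<exists>n. norm (z n) < \<epsilon>"
proof -
  define s where "s n = sum z {..<n}" for n
  have smono: "s m \<le> s n" if "m \<le> n" for m n
    unfolding s_def using that nn by (intro sum_mono2) auto
  have "0 \<le> e" using nn[of 0] le[of 0] by simp
  then have se: "s n \<le> e" for n
    unfolding s_def using nn le dis by (intro disjoint_sum_le) (auto simp: pairwise_def)
  define U where "U = {y. \<forall>n. s n \<le> y}"
  define D where "D = {y - s n | y n. y \<in> U}"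
  have "downward_directed D"
    unfolding downward_directed_def
  proof (intro conjI ballI)
    show "D \<noteq> {}" using se by (auto simp: D_def U_def)
    fix x x' assume "x \<in> D" "x' \<in> D"
    then obtain y n y' n' where *: "x = y - s n" "x' = y' - s n'" "y \<in> U" "y' \<in> U"
      by (auto simp: D_def)
    have "inf y y' - s (max n n') \<in> D" using * by (auto simp: D_def U_def)
    moreover have "inf y y' - s (max n n') \<le> x" "inf y y' - s (max n n') \<le> x'"
      using * smono by (auto intro!: diff_mono)
    ultimately show "\<exists>w\<in>D. w \<le> x \<and> w \<le> x'" by blast
  qed
  moreover have "is_infimum 0 D"
    unfolding is_infimum_def
  proof (intro conjI ballI allI impI)
    show "0 \<le> x" if "x \<in> D" for x using that by (auto simp: D_def U_def)
    fix l assume "\<forall>x\<in>D. l \<le> x"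
    define m where "m = sup l 0"
    have m: "m \<le> y - s n" if "y \<in> U" for y n
      using that \<open>\<forall>x\<in>D. l \<le> x\<close> by (auto simp: D_def U_def m_def)
    have U: "e - real k *\<^sub>R m \<in> U" for k
    proof (induction k)
      case (Suc k)
      show ?case using m[OF Suc] by (auto simp: U_def algebra_simps)
    qed (simp add: U_def se)
    have "m = 0"
    proof (rule archimedean_eq_0)
      fix k show "real k *\<^sub>R m \<le> e - s 0" using U[of k] by (auto simp: U_def algebra_simps)
    qed (simp add: m_def)
    then show "l \<le> 0" by (metis m_def sup.cobounded1)
  qed
  ultimately obtain d where "d \<in> D" "norm d < \<epsilon>"
    using oc \<open>\<epsilon> > 0\<close> unfolding order_continuous_norm_def by blast
  then obtain y n where yn: "y \<in> U" "norm (y - s n) < \<epsilon>" by (auto simp: D_def)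
  have "s (Suc n) \<le> y" using yn by (auto simp: U_def)
  then have "z n \<le> y - s n" by (simp add: s_def algebra_simps)
  then have "norm (z n) \<le> norm (y - s n)" using nn by (intro norm_mono_pos)
  with yn(2) have "norm (z n) < \<epsilon>" by linarith
  then show ?thesis ..
qed

text \<open>
  Splitting repeatedly: a non-atom dominates two disjoint nonzero elements \<open>u\<close> and \<open>v\<close>, where \<open>u\<close>
  becomes the next term and \<open>v\<close> is split further.
\<close>

lemma atomless_disjoint_sequence:
  fixes y :: "'a::banach_lattice"
  assumes al: "atomless TYPE('a)" and "0 < y"
  obtains a where "\<And>n. 0 < a n" "\<And>n. a n \<le> y"
    "pairwise (\<lambda>i j. inf (a i) (a j) = 0) (UNIV :: nat set)"
proof -
  have split: "\<exists>u v. 0 < u \<and> u \<le> x \<and> 0 < v \<and> v \<le> x \<and> inf u v = 0" if "0 < x" for x :: 'a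
  proof -
    have "\<not> atom x" using al by (auto simp: atomless_def)
    with that obtain f1 f2 where "0 \<le> f1" "f1 \<le> x" "0 \<le> f2" "f2 \<le> x"
      "disjoint_elements f1 f2" "f1 \<noteq> 0" "f2 \<noteq> 0"
      unfolding atom_def by blast
    then have "0 < f1 \<and> f1 \<le> x \<and> 0 < f2 \<and> f2 \<le> x \<and> inf f1 f2 = 0"
      by (auto simp: disjoint_elements_def less_le)
    then show ?thesis by blast
  qed
  then obtain u v where
    uv: "\<And>x::'a. 0 < x \<Longrightarrow> 0 < u x \<and> u x \<le> x \<and> 0 < v x \<and> v x \<le> x \<and> inf (u x) (v x) = 0"
    by metis
  define r where "r n = (v ^^ n) y" for n
  have rpos: "0 < r n" for n
    by (induction n) (use uv \<open>0 < y\<close> in \<open>auto simp: r_def\<close>)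
  have rdec: "r n \<le> r m" if "m \<le> n" for m n
    using that by (rule lift_Suc_antimono_le[rotated]) (use uv rpos in \<open>auto simp: r_def\<close>)
  have lt: "inf (u (r m)) (u (r n)) = 0" if "m < n" for m n
  proof (rule antisym)
    have "u (r n) \<le> r n" using uv rpos by blast
    also have "r n \<le> r (Suc m)" using that by (intro rdec) simp
    also have "r (Suc m) = v (r m)" by (simp add: r_def)
    finally have "inf (u (r m)) (u (r n)) \<le> inf (u (r m)) (v (r m))" by (meson inf_mono order_refl)
    then show "inf (u (r m)) (u (r n)) \<le> 0" using uv[OF rpos[of m]] by simp
    show "0 \<le> inf (u (r m)) (u (r n))" using uv[OF rpos[of m]] uv[OF rpos[of n]] by (simp add: less_imp_le)
  qed
  show thesis
  proof
    show "0 < u (r n)" for n using uv rpos by blast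
    show "u (r n) \<le> y" for n
      using uv[OF rpos[of n]] rdec[of 0 n] order_trans[of "u (r n)" "r n" y] by (simp add: r_def)
    show "pairwise (\<lambda>i j. inf (u (r i)) (u (r j)) = 0) UNIV"
      unfolding pairwise_def using lt by (metis inf.commute linorder_neqE_nat)
  qed
qed

text \<open>
  The supremum of the elements \<open>inf (k x) e\<close> is the projection of \<open>e\<close> onto the band generated by
  \<open>x\<close>. Bounding all of them says that this part of \<open>e\<close> is small without requiring it to exist.
  Multiples of \<open>x\<close> must be included: otherwise scaling alone would make \<open>x\<close> small, and sums of
  scaled elements could not exhaust \<open>e\<close>.
\<close>

definition small_support :: "real \<Rightarrow> 'a::banach_lattice \<Rightarrow> 'a \<Rightarrow> bool" where
  "small_support \<delta> e x \<longleftrightarrow> (\<forall>k::nat. norm (inf (real k *\<^sub>R x) e) \<le> \<delta>)"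

text \<open>
  If the terms of a disjoint sequence below \<open>y\<close> all failed, suitable \<open>inf (k\<^sub>n a\<^sub>n) e\<close> would form an
  order bounded disjoint sequence with all norms above \<open>\<delta>\<close>, which order continuity forbids.
\<close>

lemma exists_small_support:
  fixes y e :: "'a::banach_lattice"
  assumes "atomless TYPE('a)" "order_continuous_norm TYPE('a)"
    and "0 < y" "0 \<le> e" "\<delta> > 0"
  shows "\<exists>x. 0 < x \<and> x \<le> y \<and> small_support \<delta> e x"
proof (rule ccontr)
  assume none: "\<not> ?thesis"
  obtain a where a: "\<And>n. 0 < a n" "\<And>n. a n \<le> y"
    "pairwise (\<lambda>i j. inf (a i) (a j) = 0) (UNIV :: nat set)"
    using atomless_disjoint_sequence[OF assms(1,3)] by blast
  have "\<forall>n. \<exists>k. norm (inf (real k *\<^sub>R a n) e) > \<delta>"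
    using none a by (metis not_le small_support_def)
  then obtain k where k: "\<And>n. norm (inf (real (k n) *\<^sub>R a n) e) > \<delta>" by metis
  have "\<exists>n. norm (inf (real (k n) *\<^sub>R a n) e) < \<delta>"
  proof (rule disjoint_sequence_norm_small[OF assms(2)])
    show "0 \<le> inf (real (k n) *\<^sub>R a n) e" for n
      using a(1)[of n] assms by (simp add: scaleR_nonneg_nonneg less_imp_le)
    show "pairwise (\<lambda>i j. inf (inf (real (k i) *\<^sub>R a i) e) (inf (real (k j) *\<^sub>R a j) e) = 0) UNIV"
      using a assms unfolding pairwise_def by (auto intro!: disjoint_scaled_inf less_imp_le)
    show "inf (real (k n) *\<^sub>R a n) e \<le> e" for n by simp
  qed (use assms in auto)
  with k show False by (meson less_asym)
qed

text \<open>
  Take a maximal disjoint set \<open>X\<close> of positive elements with small support. The remainders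
  \<open>e - (\<Sum>x\<in>F. inf (k x) e)\<close>, for finite \<open>F \<subseteq> X\<close>, are directed downwards, and by order continuity it
  is enough that their infimum is \<open>0\<close>. A positive lower bound \<open>m\<close> is disjoint from every element of
  \<open>X\<close>; if it were nonzero, an element with small support below \<open>m\<close> would contradict maximality.
\<close>

lemma small_disjoint_pieces:
  fixes e :: "'a::banach_lattice"
  assumes "atomless TYPE('a)" "order_continuous_norm TYPE('a)"
    and e: "0 \<le> e" and "\<delta> > 0" "\<epsilon> > 0"
  obtains F :: "'a set" and p where "finite F" "\<And>x. x \<in> F \<Longrightarrow> 0 \<le> p x"
    "pairwise (\<lambda>x y. inf (p x) (p y) = 0) F" "\<And>x. x \<in> F \<Longrightarrow> norm (p x) \<le> \<delta>"
    "sum p F \<le> e" "norm (e - sum p F) < \<epsilon>"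
proof -
  define \<X> where "\<X> = {X. (\<forall>x\<in>X. 0 < x \<and> small_support \<delta> e x) \<and> pairwise (\<lambda>x y. inf x y = 0) X}"
  have "\<exists>M\<in>\<X>. \<forall>X\<in>\<X>. M \<subseteq> X \<longrightarrow> X = M"
  proof (rule subset_Zorn_nonempty)
    show "\<X> \<noteq> {}" by (auto simp: \<X>_def intro: exI[of _ "{}"])
    fix \<C> assume C: "\<C> \<noteq> {}" "subset.chain \<X> \<C>"
    have "pairwise (\<lambda>x y. inf x y = 0) (\<Union>\<C>)"
      unfolding pairwise_def
    proof (intro ballI impI)
      fix x y assume "x \<in> \<Union>\<C>" "y \<in> \<Union>\<C>" "x \<noteq> y"
      then obtain X Y where "X \<in> \<C>" "Y \<in> \<C>" "x \<in> X" "y \<in> Y" by blast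
      with C obtain Z where "Z \<in> \<X>" "x \<in> Z" "y \<in> Z"
        unfolding subset_chain_def by blast
      with \<open>x \<noteq> y\<close> show "inf x y = 0" by (auto simp: \<X>_def pairwise_def)
    qed
    then show "\<Union>\<C> \<in> \<X>" using C unfolding subset_chain_def by (auto simp: \<X>_def)
  qed
  then obtain X where X: "X \<in> \<X>" and maximal: "\<And>Y. Y \<in> \<X> \<Longrightarrow> X \<subseteq> Y \<Longrightarrow> Y = X" by blast
  have Xpos: "0 \<le> x" and Xsmall: "small_support \<delta> e x" if "x \<in> X" for x
    using X that by (auto simp: \<X>_def)
  define p where "p k x = inf (real k *\<^sub>R x) e" for k :: nat and x
  have p0: "0 \<le> p k x" if "x \<in> X" for k x
    using Xpos[OF that] e by (simp add: p_def scaleR_nonneg_nonneg)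
  have pmono: "p k x \<le> p m x" if "x \<in> X" "k \<le> m" for k m x
    unfolding p_def using that Xpos by (intro inf_mono scaleR_right_mono) auto
  have pdis: "pairwise (\<lambda>x y. inf (p k x) (p k y) = 0) F" if "F \<subseteq> X" for F k
    using that X Xpos e unfolding pairwise_def p_def \<X>_def
    by (auto intro!: disjoint_scaled_inf simp: pairwise_def subset_iff)
  have ple: "sum (p k) F \<le> e" if "finite F" "F \<subseteq> X" for F k
    using that e p0 pdis[OF that(2)] by (intro disjoint_sum_le) (auto simp: p_def)
  define D where "D = {e - sum (p k) F | k F. finite F \<and> F \<subseteq> X}"
  have "downward_directed D"
    unfolding downward_directed_def
  proof (intro conjI ballI)
    show "D \<noteq> {}" by (auto simp: D_def)
    fix x x' assume "x \<in> D" "x' \<in> D"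
    then obtain k F k' F' where *: "x = e - sum (p k) F" "finite F" "F \<subseteq> X"
      "x' = e - sum (p k') F'" "finite F'" "F' \<subseteq> X"
      by (auto simp: D_def)
    have mono: "sum (p i) G \<le> sum (p (max k k')) (F \<union> F')"
      if "i \<le> max k k'" "G \<subseteq> F \<union> F'" for i G
    proof -
      have "sum (p i) G \<le> sum (p (max k k')) G"
        using * that by (intro sum_mono pmono) auto
      also have "\<dots> \<le> sum (p (max k k')) (F \<union> F')"
        using * that p0 by (intro sum_mono2) auto
      finally show ?thesis .
    qed
    have "e - sum (p (max k k')) (F \<union> F') \<in> D" using * by (auto simp: D_def)
    moreover have "e - sum (p (max k k')) (F \<union> F') \<le> x" "e - sum (p (max k k')) (F \<union> F') \<le> x'"
      unfolding * by (intro diff_left_mono mono; simp)+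
    ultimately show "\<exists>w\<in>D. w \<le> x \<and> w \<le> x'" by blast
  qed
  moreover have "is_infimum 0 D"
    unfolding is_infimum_def
  proof (intro conjI ballI allI impI)
    show D0: "0 \<le> x" if "x \<in> D" for x using that ple by (auto simp: D_def)
    fix l assume l: "\<forall>x\<in>D. l \<le> x"
    define m where "m = sup l 0"
    have m0: "0 \<le> m" by (simp add: m_def)
    have mD: "m \<le> x" if "x \<in> D" for x
      using that l D0 by (simp add: m_def)
    \<comment> \<open>For \<open>z = inf m x\<close>, if \<open>k z \<le> e\<close> then \<open>k z \<le> inf (k x) e \<le> e - m \<le> e - z\<close>, so that
        \<open>(k + 1) z \<le> e\<close>; induction makes all multiples of \<open>z\<close> bounded by \<open>e\<close>.\<close>
    have mdis: "inf m x = 0" if "x \<in> X" for x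
    proof -
      define z where "z = inf m x"
      have z0: "0 \<le> z" using m0 Xpos[OF that] by (simp add: z_def)
      have ze: "z + p k x \<le> e" for k
      proof -
        have "e - sum (p k) {x} \<in> D" using that unfolding D_def by blast
        then have "m \<le> e - p k x" using mD by fastforce
        then have "m + p k x \<le> e" by (simp add: algebra_simps)
        moreover have "z \<le> m" by (simp add: z_def)
        ultimately show ?thesis by (meson add_right_mono order_trans)
      qed
      have "real k *\<^sub>R z \<le> e" for k
      proof (induction k)
        case (Suc k)
        have "real k *\<^sub>R z \<le> real k *\<^sub>R x" by (intro scaleR_left_mono) (auto simp: z_def)
        with Suc have "real k *\<^sub>R z \<le> p k x" by (simp add: p_def)
        then have "z + real k *\<^sub>R z \<le> e" using ze[of k] by (meson add_left_mono order_trans)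
        then show ?case by (simp add: algebra_simps)
      qed (simp add: e)
      with z0 have "z = 0" by (rule archimedean_eq_0)
      then show ?thesis by (simp add: z_def)
    qed
    have "m = 0"
    proof (rule ccontr)
      assume "m \<noteq> 0"
      with m0 have "0 < m" by simp
      then obtain x where x: "0 < x" "x \<le> m" "small_support \<delta> e x"
        using exists_small_support[OF assms(1,2) _ e \<open>\<delta> > 0\<close>] by blast
      have xdis: "inf x y = 0" "inf y x = 0" if "y \<in> X" for y
      proof -
        have "inf x y \<le> inf m y" using x(2) by (meson inf_mono order_refl)
        then show "inf x y = 0" using mdis[OF that] x(1) Xpos[OF that] by (intro antisym) auto
        then show "inf y x = 0" by (simp add: inf.commute)
      qed
      have "insert x X \<in> \<X>"
        using X x xdis by (auto simp: \<X>_def pairwise_insert)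
      then have "x \<in> X" using maximal by blast
      then show False using xdis(1)[of x] x(1) by simp
    qed
    then show "l \<le> 0" by (metis m_def sup.cobounded1)
  qed
  ultimately obtain d where "d \<in> D" "norm d < \<epsilon>"
    using assms(2) \<open>\<epsilon> > 0\<close> unfolding order_continuous_norm_def by blast
  then obtain k F where kF: "finite F" "F \<subseteq> X" "norm (e - sum (p k) F) < \<epsilon>"
    by (auto simp: D_def)
  show thesis
  proof (rule that[of F "p k"])
    show "norm (p k x) \<le> \<delta>" if "x \<in> F" for x
      using Xsmall[of x] that kF(2) by (auto simp: small_support_def p_def)
  qed (use kF p0 pdis ple in auto)
qed

section \<open>Finite-rank perturbations of positive operators\<close>

text \<open>
  Greedy choice: a new vector enters with the sign for which its inner product with the sum chosen
  so far is nonpositive, so that the square of the Euclidean length of \<open>(\<phi> b)\<^bsub>b\<in>B\<^esub>\<close> grows by at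
  most the square of the length of the new vector.
\<close>

lemma balancing_signs:
  fixes p :: "'i \<Rightarrow> 'a::real_vector" and \<phi> :: "'b \<Rightarrow> 'a \<Rightarrow> real"
  assumes "finite F" and lin: "\<And>b. b \<in> B \<Longrightarrow> linear (\<phi> b)"
  shows "\<exists>s. (\<forall>i. s i = 1 \<or> s i = - 1) \<and>
    (\<Sum>b\<in>B. (\<phi> b (\<Sum>i\<in>F. s i *\<^sub>R p i))\<^sup>2) \<le> (\<Sum>i\<in>F. \<Sum>b\<in>B. (\<phi> b (p i))\<^sup>2)"
  using assms(1)
proof (induction F rule: finite_induct)
  case empty
  show ?case using lin by (intro exI[of _ "\<lambda>_. 1"]) (simp add: linear_0)
next
  case (insert a F)
  then obtain s where s: "\<And>i. s i = 1 \<or> s i = - 1"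
    "(\<Sum>b\<in>B. (\<phi> b (\<Sum>i\<in>F. s i *\<^sub>R p i))\<^sup>2) \<le> (\<Sum>i\<in>F. \<Sum>b\<in>B. (\<phi> b (p i))\<^sup>2)"
    by blast
  define r where "r = (\<Sum>i\<in>F. s i *\<^sub>R p i)"
  define c where "c = (\<Sum>b\<in>B. \<phi> b r * \<phi> b (p a))"
  define t :: real where "t = (if c \<le> 0 then 1 else - 1)"
  have "(\<Sum>b\<in>B. (\<phi> b (t *\<^sub>R p a + r))\<^sup>2)
      = (\<Sum>b\<in>B. (\<phi> b (p a))\<^sup>2 + (\<phi> b r)\<^sup>2 + 2 * t * (\<phi> b r * \<phi> b (p a)))"
    using lin by (intro sum.cong)
      (auto simp: linear_add linear_scale power2_eq_square algebra_simps t_def)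
  also have "\<dots> = (\<Sum>b\<in>B. (\<phi> b (p a))\<^sup>2) + (\<Sum>b\<in>B. (\<phi> b r)\<^sup>2) + 2 * t * c"
    by (simp add: sum.distrib c_def sum_distrib_left)
  also have "\<dots> \<le> (\<Sum>b\<in>B. (\<phi> b (p a))\<^sup>2) + (\<Sum>i\<in>F. \<Sum>b\<in>B. (\<phi> b (p i))\<^sup>2)"
    using s(2) by (simp add: r_def t_def)
  finally have *: "(\<Sum>b\<in>B. (\<phi> b (t *\<^sub>R p a + r))\<^sup>2)
      \<le> (\<Sum>b\<in>B. (\<phi> b (p a))\<^sup>2) + (\<Sum>i\<in>F. \<Sum>b\<in>B. (\<phi> b (p i))\<^sup>2)" .
  have "(\<Sum>i\<in>insert a F. (s(a := t)) i *\<^sub>R p i) = t *\<^sub>R p a + r"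
    using insert.hyps by (auto simp: r_def intro!: sum.cong)
  with * insert.hyps s(1) show ?case
    by (intro exI[of _ "s(a := t)"]) (auto simp: t_def)
qed

lemma finite_rank_balanced:
  fixes P :: "'a::banach_lattice \<Rightarrow> 'a"
  assumes "atomless TYPE('a)" "order_continuous_norm TYPE('a)"
    and lin: "linear P" and bnd: "\<And>x. norm (P x) \<le> K * norm x"
    and ran: "finite B0" "\<And>x. P x \<in> span B0"
    and e: "0 \<le> e" and eps: "\<epsilon> > 0"
  shows "\<exists>r. \<bar>r\<bar> \<le> e \<and> norm (e - \<bar>r\<bar>) < \<epsilon> \<and> norm (P r) \<le> \<epsilon>"
proof -
  obtain B where B: "B \<subseteq> B0" "independent B" "B0 \<subseteq> span B"
    using maximal_independent_subset[of B0] by blast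
  have finB: "finite B" using B(1) ran(1) finite_subset by blast
  have ranB: "P x \<in> span B" for x
    using ran(2)[of x] B(3) span_mono[of B0 "span B"] by (auto simp: span_span)
  define \<phi> where "\<phi> b x = representation B (P x) b" for b x
  have Peq: "P x = (\<Sum>b\<in>B. \<phi> b x *\<^sub>R b)" for x
    unfolding \<phi>_def using sum_representation_eq[OF B(2) ranB finB order_refl] by simp
  have \<phi>lin: "linear (\<phi> b)" for b
    using B(2) ranB by (intro linearI)
      (simp_all add: \<phi>_def linear_add[OF lin] linear_scale[OF lin] representation_add representation_scale)
  obtain C where C: "\<And>c b. b \<in> B \<Longrightarrow> \<bar>c b\<bar> \<le> C * norm (\<Sum>b\<in>B. c b *\<^sub>R b)"
    using coordinates_bounded[OF finB B(2)] by blast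
  define L where "L = \<bar>C\<bar> * \<bar>K\<bar> + 1"
  have L: "L > 0" by (simp add: L_def add_nonneg_pos)
  have \<phi>bnd: "\<bar>\<phi> b x\<bar> \<le> L * norm x" if "b \<in> B" for b x
  proof -
    have "\<bar>\<phi> b x\<bar> \<le> C * norm (P x)" using C[OF that, of "\<lambda>b. \<phi> b x"] by (simp add: Peq)
    also have "\<dots> \<le> \<bar>C\<bar> * (\<bar>K\<bar> * norm x)"
      using order_trans[OF bnd[of x] mult_right_mono[OF abs_ge_self[of K] norm_ge_zero[of x]]]
      by (intro mult_mono) auto
    also have "\<dots> \<le> L * norm x" by (simp add: L_def algebra_simps)
    finally show ?thesis .
  qed
  define N where "N = (\<Sum>b\<in>B. norm b) + 1"
  have N: "N > 0" by (simp add: N_def sum_nonneg add_nonneg_pos)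
  define G where "G = real (card B) * L * (L * norm e) + 1"
  have G: "G > 0" using L by (simp add: G_def add_nonneg_pos)
  \<comment> \<open>Below, the squared coordinates of \<open>P r\<close> add up to at most \<open>G * \<delta>\<close>; the factor \<open>N\<close> converts a
      bound on the coordinates into one on the norm.\<close>
  define \<delta> where "\<delta> = (\<epsilon> / N)\<^sup>2 / G"
  have \<delta>: "\<delta> > 0" using eps N G by (simp add: \<delta>_def)
  obtain F :: "'a set" and p where F: "finite F" "\<And>x. x \<in> F \<Longrightarrow> 0 \<le> p x"
    "pairwise (\<lambda>x y. inf (p x) (p y) = 0) F" "\<And>x. x \<in> F \<Longrightarrow> norm (p x) \<le> \<delta>"
    "sum p F \<le> e" "norm (e - sum p F) < \<epsilon>"
    using small_disjoint_pieces[OF assms(1,2) e \<delta> eps] by blast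
  obtain s where s: "\<And>i. s i = 1 \<or> s i = - 1"
    "(\<Sum>b\<in>B. (\<phi> b (\<Sum>i\<in>F. s i *\<^sub>R p i))\<^sup>2) \<le> (\<Sum>i\<in>F. \<Sum>b\<in>B. (\<phi> b (p i))\<^sup>2)"
    using balancing_signs[OF F(1), of B \<phi> p] \<phi>lin by blast
  define r where "r = (\<Sum>i\<in>F. s i *\<^sub>R p i)"
  have absr: "\<bar>r\<bar> = sum p F"
    unfolding r_def using F s(1) by (intro abs_signed_disjoint_sum) auto
  \<comment> \<open>The signs of the numbers \<open>\<phi> b (p i)\<close> turn the sum of their absolute values into one value of
      \<open>\<phi> b\<close>, taken at an element of modulus at most \<open>e\<close>.\<close>
  have var: "(\<Sum>i\<in>F. \<bar>\<phi> b (p i)\<bar>) \<le> L * norm e" if b: "b \<in> B" for b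
  proof -
    define t where "t i = (if 0 \<le> \<phi> b (p i) then 1 else - 1 :: real)" for i
    have "(\<Sum>i\<in>F. \<bar>\<phi> b (p i)\<bar>) = \<phi> b (\<Sum>i\<in>F. t i *\<^sub>R p i)"
      unfolding linear_sum[OF \<phi>lin] linear_scale[OF \<phi>lin]
      by (intro sum.cong) (auto simp: t_def)
    also have "\<dots> \<le> L * norm (\<Sum>i\<in>F. t i *\<^sub>R p i)"
      using \<phi>bnd[OF b, of "\<Sum>i\<in>F. t i *\<^sub>R p i"] by linarith
    also have "norm (\<Sum>i\<in>F. t i *\<^sub>R p i) \<le> norm e"
    proof (rule norm_mono_abs)
      have "\<bar>\<Sum>i\<in>F. t i *\<^sub>R p i\<bar> = sum p F"
        using F by (intro abs_signed_disjoint_sum) (auto simp: t_def)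
      then show "\<bar>\<Sum>i\<in>F. t i *\<^sub>R p i\<bar> \<le> \<bar>e\<bar>" using F(5) e by simp
    qed
    finally show ?thesis using L by simp
  qed
  have "(\<Sum>b\<in>B. (\<phi> b r)\<^sup>2) \<le> (\<Sum>b\<in>B. \<Sum>i\<in>F. (\<phi> b (p i))\<^sup>2)"
    using s(2) unfolding r_def by (subst sum.swap)
  also have "\<dots> \<le> (\<Sum>b\<in>B. \<Sum>i\<in>F. (L * \<delta>) * \<bar>\<phi> b (p i)\<bar>)"
  proof (intro sum_mono)
    fix b i assume bi: "b \<in> B" "i \<in> F"
    have "\<bar>\<phi> b (p i)\<bar> \<le> L * norm (p i)" by (rule \<phi>bnd[OF bi(1)])
    also have "\<dots> \<le> L * \<delta>" using F(4)[OF bi(2)] L by simp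
    finally have "\<bar>\<phi> b (p i)\<bar> * \<bar>\<phi> b (p i)\<bar> \<le> (L * \<delta>) * \<bar>\<phi> b (p i)\<bar>"
      by (rule mult_right_mono) simp
    then show "(\<phi> b (p i))\<^sup>2 \<le> (L * \<delta>) * \<bar>\<phi> b (p i)\<bar>" by (simp add: power2_eq_square)
  qed
  also have "\<dots> \<le> (\<Sum>b\<in>B. (L * \<delta>) * (L * norm e))"
    using var L \<delta> by (intro sum_mono) (simp flip: sum_distrib_left)
  also have "\<dots> = real (card B) * L * (L * norm e) * \<delta>" by simp
  also have "\<dots> \<le> G * \<delta>" using \<delta> by (intro mult_right_mono) (auto simp: G_def)
  also have "\<dots> = (\<epsilon> / N)\<^sup>2" using G by (simp add: \<delta>_def)
  finally have sq: "(\<Sum>b\<in>B. (\<phi> b r)\<^sup>2) \<le> (\<epsilon> / N)\<^sup>2" .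
  have coord: "\<bar>\<phi> b r\<bar> \<le> \<epsilon> / N" if "b \<in> B" for b
  proof (rule power2_le_imp_le)
    have "(\<phi> b r)\<^sup>2 \<le> (\<Sum>b\<in>B. (\<phi> b r)\<^sup>2)"
      using that finB by (intro member_le_sum) auto
    with sq show "\<bar>\<phi> b r\<bar>\<^sup>2 \<le> (\<epsilon> / N)\<^sup>2" by simp
  qed (use eps N in simp)
  have "norm (P r) \<le> (\<Sum>b\<in>B. \<bar>\<phi> b r\<bar> * norm b)"
    unfolding Peq[of r] by (rule order_trans[OF norm_sum]) simp
  also have "\<dots> \<le> (\<Sum>b\<in>B. \<epsilon> / N * norm b)"
    using coord by (intro sum_mono mult_right_mono) auto
  also have "\<dots> = \<epsilon> / N * (\<Sum>b\<in>B. norm b)" by (simp add: sum_distrib_left)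
  also have "\<dots> \<le> \<epsilon> / N * N" using eps N by (intro mult_left_mono) (auto simp: N_def)
  finally have "norm (P r) \<le> \<epsilon>" using N by simp
  with absr F(5,6) show ?thesis by (intro exI[of _ r]) simp
qed

lemma positive_finite_rank_perturbation:
  fixes Q :: "'a::banach_lattice \<Rightarrow> 'a"
  assumes "atomless TYPE('a)" "order_continuous_norm TYPE('a)"
    and lin: "linear Q" and pos: "\<And>x. 0 \<le> x \<Longrightarrow> 0 \<le> Q x"
    and ran: "finite B" "\<And>x. x - Q x \<in> span B"
    and e: "0 \<le> e"
  shows "norm e \<le> norm (Q e)"
proof (rule field_le_epsilon)
  fix \<epsilon> :: real assume "\<epsilon> > 0"
  obtain K where K: "\<And>x. norm (Q x) \<le> K * norm x"
    using positive_operator_bounded[OF lin pos] by blast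
  have "linear (\<lambda>x. x - Q x)"
    using lin by (intro linear_compose_sub linear_ident)
  moreover have "norm (x - Q x) \<le> (1 + K) * norm x" for x
    using norm_triangle_ineq4[of x "Q x"] K[of x] by (simp add: algebra_simps)
  ultimately obtain r where r: "\<bar>r\<bar> \<le> e" "norm (e - \<bar>r\<bar>) < \<epsilon> / 2" "norm (r - Q r) \<le> \<epsilon> / 2"
    using finite_rank_balanced[where P = "\<lambda>x. x - Q x" and K = "1 + K" and \<epsilon> = "\<epsilon> / 2",
        OF assms(1,2) _ _ ran e]
      \<open>\<epsilon> > 0\<close> by auto
  have mono: "Q x \<le> Q y" if "x \<le> y" for x y
    using pos[of "y - x"] that by (simp add: linear_diff[OF lin])
  have "Q r \<le> Q e" using r(1) by (intro mono) (meson abs_ge_self order_trans)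
  moreover have "- Q r \<le> Q e"
    using mono[of "- r" e] r(1) abs_ge_minus_self[of r] by (simp add: linear_neg[OF lin])
  ultimately have "\<bar>Q r\<bar> \<le> \<bar>Q e\<bar>" using pos[OF e] by (simp add: abs_le_iff)
  then have "norm (Q r) \<le> norm (Q e)" by (rule norm_mono_abs)
  moreover have "norm r \<le> norm (r - Q r) + norm (Q r)"
    using norm_triangle_ineq[of "r - Q r" "Q r"] by simp
  moreover have "norm e \<le> norm (e - \<bar>r\<bar>) + norm r"
    using norm_triangle_ineq[of "e - \<bar>r\<bar>" "\<bar>r\<bar>"] by (simp add: norm_abs_eq)
  ultimately show "norm e \<le> norm (Q e) + \<epsilon>" using r by linarith
qed

section \<open>Residual projections of a decomposition\<close>

lemma basis_projection_finite_rank: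
  assumes "fdd E"
  shows "\<exists>B. finite B \<and> (\<forall>x. basis_projection E n x \<in> span B)"
proof -
  obtain B where B: "\<And>k. finite (B k) \<and> E k = span (B k)"
    using assms unfolding fdd_def by metis
  have "basis_projection E n x \<in> span (\<Union>k\<le>n. B k)" for x
    unfolding basis_projection_def
  proof (rule span_sum)
    fix k assume "k \<in> {..n}"
    then have "span (B k) \<subseteq> span (\<Union>k\<le>n. B k)" by (intro span_mono) auto
    then show "fdd_component E x k \<in> span (\<Union>k\<le>n. B k)"
      using fdd_component(1)[OF assms, of x k] B by blast
  qed
  then show ?thesis using B by (intro exI[of _ "\<Union>k\<le>n. B k"]) auto
qed

lemma residual_projection_tendsto_0:
  assumes "fdd E"
  shows "(\<lambda>n. residual_projection E n e) \<longlonglongrightarrow> 0"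
proof -
  have "(\<lambda>n. basis_projection E n e) \<longlonglongrightarrow> e"
    using fdd_component(2)[OF assms, of e] unfolding sums_def_le basis_projection_def .
  then have "(\<lambda>n. e - basis_projection E n e) \<longlonglongrightarrow> e - e"
    by (intro tendsto_diff tendsto_const)
  then show ?thesis by (simp add: residual_projection_def)
qed

lemma quasi_monotone_nonneg:
  assumes "quasi_monotone M T" "linear T" "M > 0" "0 \<le> x"
  shows "0 \<le> T x"
proof -
  have "T 0 \<le> M *\<^sub>R T x" using assms by (auto simp: quasi_monotone_def)
  then have "inverse M *\<^sub>R 0 \<le> inverse M *\<^sub>R (M *\<^sub>R T x)"
    using assms(2,3) by (intro scaleR_left_mono) (auto simp: linear_0)
  then show ?thesis using assms(3) by simp
qed

theorem corollary9:
  assumes "\<exists>x::'a::banach_lattice. x \<noteq> 0"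
    and "atomless TYPE('a)"
    and "order_continuous_norm TYPE('a)"
  shows "\<not> (\<exists>E :: nat \<Rightarrow> 'a set. fdd E \<and> residually_quasi_monotone E)"
proof
  assume "\<exists>E :: nat \<Rightarrow> 'a set. fdd E \<and> residually_quasi_monotone E"
  then obtain E :: "nat \<Rightarrow> 'a set" and M where E: "fdd E"
    and M: "M > 0" "\<And>n. quasi_monotone M (residual_projection E n)"
    by (auto simp: residually_quasi_monotone_def)
  obtain x :: 'a where "x \<noteq> 0" using assms(1) by blast
  define e where "e = \<bar>x\<bar>"
  have e: "0 \<le> e" "norm e > 0" using \<open>x \<noteq> 0\<close> by (auto simp: e_def)
  have "norm e \<le> norm (residual_projection E n e)" for n
  proof -
    obtain B where B: "finite B" "\<And>x. basis_projection E n x \<in> span B"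
      using basis_projection_finite_rank[OF E] by blast
    have "x - residual_projection E n x \<in> span B" for x
      using B(2)[of x] by (simp add: residual_projection_def)
    then show ?thesis
      using positive_finite_rank_perturbation[OF assms(2,3) linear_residual_projection[OF E]
          quasi_monotone_nonneg[OF M(2) linear_residual_projection[OF E] M(1)] B(1)] e(1)
      by blast
  qed
  moreover have "(\<lambda>n. norm (residual_projection E n e)) \<longlonglongrightarrow> 0"
    using residual_projection_tendsto_0[OF E] by (rule tendsto_norm_zero)
  ultimately have "norm e \<le> 0"
    by (intro LIMSEQ_le_const[where X = "\<lambda>n. norm (residual_projection E n e)"]) auto
  with e(2) show False by simp
qed

end
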